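(* Let $p\ge 5$ be an integer, let $x$ be a right vertex of $T_H$, and let $f$ be any $2p$ distance coloring of $T_H$. Then at least two distinct colors that do not appear on $V(D_x^{2p})$ appear on $\mathcal{F}_{x,p+1}\cup\mathcal{F}_{x,p+2}\cup\mathcal{F}_{x,p+3}$; that is, $$\Big|\, f\big(\mathcal{F}_{x,p+1}\cup\mathcal{F}_{x,p+2}\cup\mathcal{F}_{x,p+3}\big)\setminus f\big(V(D_x^{2p})\big)\Big|\ \ge 2 .$$ (In the paper's words: besides the new color needed on $\mathcal{F}_{x,p+1}$, a second new color must be introduced to color $\mathcal{F}_{x,p+2}\cup\mathcal{F}_{x,p+3}$.)
   Context: $T_H$ is the infinite hexagonal grid with vertex set $\mathbb{Z}^2$: $(i,j)$ is adjacent to $(i,j\pm1)$, and $(i,j)$ is adjacent to $(i+1,j)$ iff $i+j$ is even; no other edges. A vertex $(i,j)$ with $i+j$ even is called a right vertex. $d(u,v)$ is graph distance. For $l\in\mathbb{N}$, an $l$ distance coloring is a map $f:V(T_H)\to\{1,\dots,n\}$ with $f(u)\ne f(v)$ for all distinct $u,v$ with $d(u,v)\le l$. For a vertex $x$ and integer $k\ge0$, $\mathcal{F}_{x,k}=\{u\in V(T_H): d(x,u)=k\}$. $D_x^{2p}$ is the subgraph of $T_H$ induced by $\{w: d(w,x)\le p\}$. *)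

theory Defs
  imports Main
begin

type_synonym vtx = "int \<times> int"

definition hex_adj :: "vtx \<Rightarrow> vtx \<Rightarrow> bool" where
  "hex_adj u v \<longleftrightarrow>
     (fst u = fst v \<and> (snd v = snd u + 1 \<or> snd v = snd u - 1)) \<or>
     (snd u = snd v \<and> fst v = fst u + 1 \<and> even (fst u + snd u)) \<or>
     (snd u = snd v \<and> fst u = fst v + 1 \<and> even (fst v + snd v))"

definition right_vertex :: "vtx \<Rightarrow> bool" where
  "right_vertex v \<longleftrightarrow> even (fst v + snd v)"

definition hex_dist :: "vtx \<Rightarrow> vtx \<Rightarrow> nat" where
  "hex_dist u v = (LEAST k. (hex_adj ^^ k) u v)"

definition distance_coloring :: "nat \<Rightarrow> nat \<Rightarrow> (vtx \<Rightarrow> nat) \<Rightarrow> bool" where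
  "distance_coloring l n f \<longleftrightarrow>
     (\<forall>u. f u \<in> {1..n}) \<and>
     (\<forall>u v. u \<noteq> v \<and> hex_dist u v \<le> l \<longrightarrow> f u \<noteq> f v)"

definition sphere :: "vtx \<Rightarrow> nat \<Rightarrow> vtx set" where
  "sphere x k = {u. hex_dist x u = k}"

text \<open>Vertex set of D_x^{2p}: vertices within distance p of x.\<close>
definition disk_verts :: "vtx \<Rightarrow> nat \<Rightarrow> vtx set" where
  "disk_verts x p = {w. hex_dist w x \<le> p}"

end

(* Give every vertex u on the three outer spheres a weight and every vertex v on the spheres of radius
   p - 2, p - 1, p a capacity. Vertices of the same colour are at distance more than 2p, so a colour used
   in the disk occurs there only once, at some v, and a geometric inequality bounds the weight of its outer
   vertices by the capacity of v; a colour not used in the disk gets outer weight at most 8. But the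
   total weight exceeds the total capacity by 9, so one new colour is not enough. This works for p >= 8;
   p = 5, 6, 7 are checked by enumerating the sets of pairwise far outer vertices. *)
theory Submission
  imports Defs
begin

section \<open>Cube coordinates\<close>

text \<open>Counting alone does not suffice: a disk vertex can share its colour with up to two outer
  vertices, and twice the 9p - 9 vertices on the three inner spheres exceeds the 9p + 18 outer ones.
  The weights come from one inequality for three pairwise far vectors, at most one of them in the
  disk: the sum of their \<open>min_abs\<close> is at most the sum of their norms minus (3p + 2).
  With p + 3 - \<open>l1_norm\<close> + \<open>min_abs\<close> as weight, three outer vectors weigh
  at most 3(p + 3) - (3p + 2) = 7, and two outer vectors with a disk vector v weigh at most
  \<open>l1_norm v\<close> - \<open>min_abs v\<close> + 2(p + 3) - (3p + 2), which is the first term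
  of \<open>capacity\<close>. The second terms of \<open>weight\<close> and \<open>capacity\<close>
  serve the classes with fewer members and make both functions constant on each sphere once
  \<open>min_abs\<close> is at least 2. The bound p \<ge> 8 makes the largest and smallest
  coordinates big enough for rough estimates to fix the sign patterns.\<close>

type_synonym vec = "int \<times> int \<times> int"

fun l1 :: "vec \<Rightarrow> vec \<Rightarrow> int" where
  "l1 (a, b, c) (a', b', c') = \<bar>a - a'\<bar> + \<bar>b - b'\<bar> + \<bar>c - c'\<bar>"

fun l1_norm :: "vec \<Rightarrow> int" where
  "l1_norm (a, b, c) = \<bar>a\<bar> + \<bar>b\<bar> + \<bar>c\<bar>"

fun vec_sum :: "vec \<Rightarrow> int" where
  "vec_sum (a, b, c) = a + b + c"

definition Vec :: "vec set" where
  "Vec = {u. vec_sum u \<in> {0, 1}}"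

text \<open>The grid is the set of integer triples with coordinate sum 0 (right vertices) or 1, one coordinate
  per edge direction; the graph distance becomes the l1 distance.\<close>
fun to_vtx :: "vtx \<Rightarrow> vec \<Rightarrow> vtx" where
  "to_vtx x (a, b, c) = (fst x + a, snd x + b - c)"

lemma to_vtx_onto:
  "\<exists>u\<in>Vec. to_vtx x u = v"
proof -
  define i j where "i = fst v - fst x" and "j = snd v - snd x"
  define s where "s = (i + j) mod 2"
  define b c where "b = (j - i + s) div 2" and "c = (s - i - j) div 2"
  have s: "s = 0 \<or> s = 1" unfolding s_def by presburger
  have "2 * b = j - i + s" "2 * c = s - i - j" unfolding b_def c_def s_def by presburger+
  then have "i + b + c = s" "b - c = j" by linarith+
  then have "(i, b, c) \<in> Vec" "to_vtx x (i, b, c) = v"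
    using s by (auto simp: Vec_def i_def j_def prod_eq_iff)
  then show ?thesis by blast
qed

lemma abs_sum3_eq_1:
  fixes x y z :: int
  shows "\<bar>x\<bar> + \<bar>y\<bar> + \<bar>z\<bar> = 1 \<longleftrightarrow> (x = 0 \<and> y = 0 \<and> (z = 1 \<or> z = - 1)) \<or>
    (x = 0 \<and> z = 0 \<and> (y = 1 \<or> y = - 1)) \<or> (y = 0 \<and> z = 0 \<and> (x = 1 \<or> x = - 1))"
  by (auto simp: abs_if split: if_splits)
text \<open>The left side is \<open>hex_adj\<close> in coordinate differences. Since y + z and z - y
  have the same parity, x = 0 and z - y = 1 or -1 force y + z to be 1 or -1, so one of y, z
  vanishes. If y = z, then 2 * y = s - s' - x, and parity forces s \<noteq> s' and y = z =
  0.\<close>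

lemma adj_arith:
  fixes x y z s s' :: int
  assumes "x + y + z = s - s'" "s = 0 \<or> s = 1" "s' = 0 \<or> s' = 1"
  shows "(x = 0 \<and> (z - y = 1 \<or> z - y = - 1)) \<or> (y = z \<and> x = -1 \<and> s = 0) \<or> (y = z \<and> x = 1 \<and> s' = 0)
    \<longleftrightarrow> \<bar>x\<bar> + \<bar>y\<bar> + \<bar>z\<bar> = 1"
proof -
  have z: "z = s - s' - x - y" using assms(1) by simp
  show ?thesis unfolding abs_sum3_eq_1 unfolding z using assms(2,3)
    by (elim disjE; simp) presburger+
qed
lemma hex_adj_iff:
  assumes "right_vertex x" "u \<in> Vec" "v \<in> Vec"
  shows "hex_adj (to_vtx x u) (to_vtx x v) \<longleftrightarrow> l1 u v = 1"
proof -
  obtain a b c a' b' c' i j where [simp]: "u = (a, b, c)" "v = (a', b', c')" "x = (i, j)"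
    by (metis prod_cases3 surj_pair)
  have e: "even (i + j)" using assms(1) by (simp add: right_vertex_def)
  have s: "a + b + c = 0 \<or> a + b + c = 1" "a' + b' + c' = 0 \<or> a' + b' + c' = 1"
    using assms(2,3) by (simp_all add: Vec_def)
  have "even ((i + a) + (j + b - c)) \<longleftrightarrow> a + b + c = 0"
    using e s(1) by presburger
  then have e1: "even (fst (to_vtx x u) + snd (to_vtx x u)) \<longleftrightarrow> a + b + c = 0" by simp
  have "even ((i + a') + (j + b' - c')) \<longleftrightarrow> a' + b' + c' = 0"
    using e s(2) by presburger
  then have e2: "even (fst (to_vtx x v) + snd (to_vtx x v)) \<longleftrightarrow> a' + b' + c' = 0" by simp
  have "hex_adj (to_vtx x u) (to_vtx x v) \<longleftrightarrow>
      (a - a' = 0 \<and> ((c - c') - (b - b') = 1 \<or> (c - c') - (b - b') = - 1)) \<or>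
      (b - b' = c - c' \<and> a - a' = - 1 \<and> a + b + c = 0) \<or>
      (b - b' = c - c' \<and> a - a' = 1 \<and> a' + b' + c' = 0)"
    unfolding hex_adj_def e1 e2 by auto
  also have "\<dots> \<longleftrightarrow> l1 u v = 1"
    using adj_arith[of "a - a'" "b - b'" "c - c'" "a + b + c" "a' + b' + c'"] s by simp
  finally show ?thesis .
qed

text \<open>From sum 0 only steps +1 stay in \<open>Vec\<close>, from sum 1 only steps -1;
  \<open>e\<close> is this sign. Some coordinate of v lies in direction \<open>e\<close>: otherwise
  every coordinate moves the other way, and a sum in {0, 1} then forces u = v.\<close>

lemma hex_step:
  assumes "u \<in> Vec" "v \<in> Vec" "u \<noteq> v"
  shows "\<exists>w\<in>Vec. l1 u w = 1 \<and> l1 w v = l1 u v - 1"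
proof -
  obtain a b c a' b' c' where [simp]: "u = (a, b, c)" "v = (a', b', c')"
    by (metis prod_cases3)
  define e where "e = 1 - 2 * (a + b + c)"
  have s: "a + b + c = 0 \<or> a + b + c = 1" "a' + b' + c' = 0 \<or> a' + b' + c' = 1"
    using assms by (auto simp: Vec_def)
  then have e: "e = 1 \<or> e = -1" "a + b + c + e = 0 \<or> a + b + c + e = 1"
    by (auto simp: e_def)
  have "e * (a' - a) > 0 \<or> e * (b' - b) > 0 \<or> e * (c' - c) > 0"
    using e(1)
  proof
    assume "e = 1"
    then have "a + b + c = 0" by (simp add: e_def)
    then show ?thesis using s(2) assms(3) \<open>e = 1\<close> by simp linarith
  next
    assume "e = -1"
    then have "a + b + c = 1" by (simp add: e_def)
    then show ?thesis using s(2) assms(3) \<open>e = -1\<close> by simp linarith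
  qed
  then show ?thesis
  proof (elim disjE)
    assume "e * (a' - a) > 0"
    then have "l1 u (a + e, b, c) = 1 \<and> l1 (a + e, b, c) v = l1 u v - 1"
      using e by auto
    moreover have "(a + e, b, c) \<in> Vec" using e by (auto simp: Vec_def)
    ultimately show ?thesis by blast
  next
    assume "e * (b' - b) > 0"
    then have "l1 u (a, b + e, c) = 1 \<and> l1 (a, b + e, c) v = l1 u v - 1"
      using e by auto
    moreover have "(a, b + e, c) \<in> Vec" using e by (auto simp: Vec_def)
    ultimately show ?thesis by blast
  next
    assume "e * (c' - c) > 0"
    then have "l1 u (a, b, c + e) = 1 \<and> l1 (a, b, c + e) v = l1 u v - 1"
      using e by auto
    moreover have "(a, b, c + e) \<in> Vec" using e by (auto simp: Vec_def)
    ultimately show ?thesis by blast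
  qed
qed

lemma l1_nonneg: "l1 u v \<ge> 0"
  by (cases u; cases v) simp

lemma l1_eq_0: "l1 u v = 0 \<longleftrightarrow> u = v"
  by (cases u; cases v) auto

lemma l1_triangle: "l1 u w \<le> l1 u v + l1 v w"
  by (cases u; cases v; cases w) simp

lemma hex_walk_exists:
  assumes "right_vertex x" "u \<in> Vec" "v \<in> Vec" "l1 u v = int k"
  shows "(hex_adj ^^ k) (to_vtx x u) (to_vtx x v)"
  using assms(2,4)
proof (induction k arbitrary: u)
  case 0
  then show ?case by (simp add: l1_eq_0)
next
  case (Suc k)
  then have "u \<noteq> v" using l1_eq_0[of u v] by auto
  then obtain w where w: "w \<in> Vec" "l1 u w = 1" "l1 w v = int k"
    using hex_step[OF Suc.prems(1) assms(3)] Suc.prems(2) by auto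
  have "hex_adj (to_vtx x u) (to_vtx x w)"
    using hex_adj_iff[OF assms(1) Suc.prems(1) w(1)] w(2) by simp
  then show ?case using Suc.IH[OF w(1,3)] by (metis relpowp_Suc_I2)
qed

lemma hex_walk_length:
  assumes "right_vertex x" "u \<in> Vec" "v \<in> Vec" "(hex_adj ^^ k) (to_vtx x u) (to_vtx x v)"
  shows "l1 u v \<le> int k"
  using assms(3,4)
proof (induction k arbitrary: v)
  case 0
  then have "to_vtx x u = to_vtx x v" by simp
  then have "u = v" using assms(2) 0(1) by (cases u; cases v) (auto simp: Vec_def)
  then show ?case using l1_eq_0[of v v] by simp
next
  case (Suc k)
  then obtain z where z: "(hex_adj ^^ k) (to_vtx x u) z" "hex_adj z (to_vtx x v)" by auto
  obtain w where w: "w \<in> Vec" "z = to_vtx x w" using to_vtx_onto by metis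
  have "l1 w v = 1" using hex_adj_iff[OF assms(1) w(1) Suc.prems(1)] z(2) w(2) by simp
  then show ?case using Suc.IH[OF w(1)] z(1) w(2) l1_triangle[of u v w] by simp
qed

lemma hex_dist_to_vtx:
  assumes "right_vertex x" "u \<in> Vec" "v \<in> Vec"
  shows "int (hex_dist (to_vtx x u) (to_vtx x v)) = l1 u v"
proof -
  have k: "l1 u v = int (nat (l1 u v))" by (simp add: l1_nonneg)
  have "hex_dist (to_vtx x u) (to_vtx x v) = nat (l1 u v)"
    unfolding hex_dist_def
  proof (rule Least_equality)
    show "(hex_adj ^^ nat (l1 u v)) (to_vtx x u) (to_vtx x v)"
      using hex_walk_exists[OF assms k] .
  next
    fix m assume "(hex_adj ^^ m) (to_vtx x u) (to_vtx x v)"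
    then show "nat (l1 u v) \<le> m" using hex_walk_length[OF assms] by fastforce
  qed
  then show ?thesis using k by simp
qed

section \<open>Weights of colour classes\<close>

fun min_abs :: "vec \<Rightarrow> int" where
  "min_abs (a, b, c) = min \<bar>a\<bar> (min \<bar>b\<bar> \<bar>c\<bar>)"

text \<open>Weights and capacities are a dual solution of the linear programme that packs colour classes;
  they only serve on the spheres of radius p + 1, p + 2, p + 3 and p - 2, p - 1, p respectively.\<close>
definition weight :: "int \<Rightarrow> vec \<Rightarrow> int" where
  "weight p u = min (p + 3 - l1_norm u + min_abs u) (if l1_norm u = p + 1 then 3 else 2)"

definition capacity :: "int \<Rightarrow> vec \<Rightarrow> int" where
  "capacity p v = max (l1_norm v - p + 4 - min_abs v) (if l1_norm v = p then 3 else 2)"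

lemma weight_le: "weight p u \<le> p + 3 - l1_norm u + min_abs u"
  by (simp add: weight_def)

lemma capacity_ge: "l1_norm v - p + 4 - min_abs v \<le> capacity p v"
  by (simp add: capacity_def)

section \<open>Extreme coordinates of pairwise far vectors\<close>

definition shell :: "int \<Rightarrow> int \<Rightarrow> vec set" where
  "shell r s = {u \<in> Vec. r \<le> l1_norm u \<and> l1_norm u \<le> s}"

fun argmax :: "vec \<Rightarrow> nat" where
  "argmax (a, b, c) = (if b \<le> a \<and> c \<le> a then 0 else if c \<le> b then 1 else 2)"

fun argmin :: "vec \<Rightarrow> nat" where
  "argmin (a, b, c) = (if a \<le> b \<and> a \<le> c then 0 else if b \<le> c then 1 else 2)"

fun coord :: "vec \<Rightarrow> nat \<Rightarrow> int" where
  "coord (a, b, c) i = (if i = 0 then a else if i = 1 then b else c)"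

text \<open>The positive coordinates add up to half of norm plus sum, hence to at least half the
  norm, and a sum of at most 1 leaves room for at most two of them.\<close>

lemma argmax_bound: "u \<in> Vec \<Longrightarrow> l1_norm u \<le> 4 * coord u (argmax u)"
  by (cases u) (auto simp: Vec_def abs_if)

text \<open>As for the maximum, but the negative coordinates only add up to half of norm minus sum,
  and the sum may be 1.\<close>

lemma argmin_bound: "u \<in> Vec \<Longrightarrow> l1_norm u - 1 \<le> - 4 * coord u (argmin u)"
  by (cases u) (auto simp: Vec_def abs_if; presburger)

lemma l1_le_norms: "l1 u v \<le> l1_norm u + l1_norm v"
proof -
  obtain a b c a' b' c' where [simp]: "u = (a, b, c)" "v = (a', b', c')"
    by (metis prod_cases3)
  have "l1 u v \<le> (\<bar>a\<bar> + \<bar>a'\<bar>) + (\<bar>b\<bar> + \<bar>b'\<bar>) + (\<bar>c\<bar> + \<bar>c'\<bar>)"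
    unfolding \<open>u = _\<close> \<open>v = _\<close> l1.simps by (intro add_mono abs_triangle_ineq4)
  then show ?thesis by (simp add: ac_simps)
qed

lemma l1_common_pos:
  assumes "0 \<le> m" "m \<le> coord u i" "m \<le> coord v i"
  shows "l1 u v \<le> l1_norm u + l1_norm v - 2 * m"
  using assms by (cases u; cases v) (auto split: if_splits)

lemma l1_common_neg:
  assumes "0 \<le> m" "m \<le> - coord u i" "m \<le> - coord v i"
  shows "l1 u v \<le> l1_norm u + l1_norm v - 2 * m"
  using assms by (cases u; cases v) (auto split: if_splits)

text \<open>A shared large coordinate saves twice the common amount. On the outer spheres the
  maximum is at least 3 because p + 1 \<ge> 9, on the inner ones at least 2 because p - 2 \<ge> 6;
  so a common position would give distance at most 2(p + 3) - 6 or (2p + 3) - 4.\<close>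

lemma argmax_neq:
  assumes "p \<ge> 8" "u \<in> shell (p + 1) (p + 3)" "v \<in> shell (p + 1) (p + 3) \<union> shell (p - 2) p"
    "l1 u v > 2 * p"
  shows "argmax u \<noteq> argmax v"
proof
  assume eq: "argmax u = argmax v"
  define i where "i = argmax u"
  have b: "l1_norm u \<le> 4 * coord u i" "l1_norm v \<le> 4 * coord v i"
    using argmax_bound[of u] argmax_bound[of v] assms eq by (auto simp: shell_def i_def)
  show False
    using l1_common_pos[of 3 u i v] l1_common_pos[of 2 u i v] b assms by (auto simp: shell_def)
qed

text \<open>\<open>argmin_bound\<close> loses one, so on the sphere p + 1 only -2 is guaranteed.
  There a saving of 4 is enough, the two norms adding up to at most 2p + 4. The spheres p + 2 and p
  + 3 reach -3 because p + 2 \<ge> 10.\<close>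

lemma argmin_neq:
  assumes "p \<ge> 8" "u \<in> shell (p + 1) (p + 3)" "v \<in> shell (p + 1) (p + 3) \<union> shell (p - 2) p"
    "l1 u v > 2 * p"
  shows "argmin u \<noteq> argmin v"
proof
  assume eq: "argmin u = argmin v"
  define i where "i = argmin u"
  have b: "l1_norm u - 1 \<le> - 4 * coord u i" "l1_norm v - 1 \<le> - 4 * coord v i"
    using argmin_bound[of u] argmin_bound[of v] assms eq by (auto simp: shell_def i_def)
  show False
    using l1_common_neg[of 3 u i v] l1_common_neg[of 2 u i v] b assms by (auto simp: shell_def)
qed

text \<open>The distance falls short of the norm sum S by twice min(X, max 0 z') + min(Y', max 0 (-
  z)), one term for each coordinate where the signs agree. As X and Y' alone already exceed half of
  the admissible deficit S - 2p - 1, both minima are attained by the middle coordinates.\<close>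

lemma overlap_le:
  fixes X z' Y' z A S p :: int
  assumes "2 * p < \<bar>X - z'\<bar> + A + \<bar>z + Y'\<bar>"
    and "A + X + Y' + \<bar>z\<bar> + \<bar>z'\<bar> = S"
    and "2 * X > S - 2 * p - 1" "2 * Y' > S - 2 * p - 1" "X \<ge> 0" "Y' \<ge> 0"
  shows "2 * (max 0 z' + max 0 (- z)) \<le> S - 2 * p - 1"
  using assms by (smt (verit))

text \<open>Three pairwise far vectors have their maxima in different coordinates, and also their minima, so up
  to symmetry their sign patterns are cyclic shifts of each other. Each remaining middle coordinate then
  overlaps in sign with one of the other vectors, which costs distance.\<close>
lemma cyclic_pattern:
  fixes p :: int and X Y z X1 Y1 z1 X2 Y2 z2 :: int
  defines "N \<equiv> X + Y + \<bar>z\<bar>" and "N1 \<equiv> X1 + Y1 + \<bar>z1\<bar>" and "N2 \<equiv> X2 + Y2 + \<bar>z2\<bar>"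
  assumes p: "p \<ge> 8"
    and norms: "p - 2 \<le> N" "N \<le> p + 3" "p + 1 \<le> N1" "N1 \<le> p + 3" "p + 1 \<le> N2" "N2 \<le> p + 3"
    and pos: "N \<le> 4 * X" "N1 \<le> 4 * X1" "N2 \<le> 4 * X2"
    and neg: "N - 1 \<le> 4 * Y" "N1 - 1 \<le> 4 * Y1" "N2 - 1 \<le> 4 * Y2"
    and far: "2 * p < \<bar>X - z1\<bar> + (Y + X1) + \<bar>z + Y1\<bar>"
      "2 * p < \<bar>X1 - z2\<bar> + (Y1 + X2) + \<bar>z1 + Y2\<bar>"
      "2 * p < \<bar>X2 - z\<bar> + (X + Y2) + \<bar>z2 + Y\<bar>"
  shows "\<bar>z\<bar> + \<bar>z1\<bar> + \<bar>z2\<bar> \<le> N + N1 + N2 - 3 * p - 2"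
proof -
  \<comment> \<open>Shows that an extreme coordinate is too large to be the smaller partner in an
    overlap. It serves maxima and minima alike, since n \<le> 4 * b implies n - 1 \<le> 4 *
    b.\<close>
  have big: "0 \<le> b" "n + m - 2 * p - 1 < 2 * b"
    if "n - 1 \<le> 4 * b" "p - 2 \<le> n" "n \<le> p + 3" "m \<le> p + 3" for b n m :: int
    using that p by presburger+
  have "2 * (max 0 z1 + max 0 (- z)) \<le> N + N1 - 2 * p - 1"
  proof (rule overlap_le[OF far(1)])
    show "(Y + X1) + X + Y1 + \<bar>z\<bar> + \<bar>z1\<bar> = N + N1" unfolding N_def N1_def by simp
    show "N + N1 - 2 * p - 1 < 2 * X" "0 \<le> X"
      using big[of N X N1] pos neg norms by linarith+
    show "N + N1 - 2 * p - 1 < 2 * Y1" "0 \<le> Y1"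
      using big[of N1 Y1 N] pos neg norms by linarith+
  qed
  moreover have "2 * (max 0 z2 + max 0 (- z1)) \<le> N1 + N2 - 2 * p - 1"
  proof (rule overlap_le[OF far(2)])
    show "(Y1 + X2) + X1 + Y2 + \<bar>z1\<bar> + \<bar>z2\<bar> = N1 + N2" unfolding N1_def N2_def by simp
    show "N1 + N2 - 2 * p - 1 < 2 * X1" "0 \<le> X1"
      using big[of N1 X1 N2] pos neg norms by linarith+
    show "N1 + N2 - 2 * p - 1 < 2 * Y2" "0 \<le> Y2"
      using big[of N2 Y2 N1] pos neg norms by linarith+
  qed
  moreover have "2 * (max 0 z + max 0 (- z2)) \<le> N2 + N - 2 * p - 1"
  proof (rule overlap_le[OF far(3)])
    show "(X + Y2) + X2 + Y + \<bar>z2\<bar> + \<bar>z\<bar> = N2 + N" unfolding N_def N2_def by simp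
    show "N2 + N - 2 * p - 1 < 2 * X2" "0 \<le> X2"
      using big[of N2 X2 N] pos neg norms by linarith+
    show "N2 + N - 2 * p - 1 < 2 * Y" "0 \<le> Y"
      using big[of N Y N2] pos neg norms by linarith+
  qed
  moreover have "\<bar>t\<bar> = max 0 t + max 0 (- t)" for t :: int
    by auto
  \<comment> \<open>Adding the three bounds and halving leaves the constant -3p - 3/2, which
    integrality improves to -3p - 2.\<close>
  moreover have "(a + b) + (a1 + b1) + (a2 + b2) \<le> N + N1 + N2 - 3 * p - 2"
    if "2 * (a1 + b) \<le> N + N1 - 2 * p - 1" "2 * (a2 + b1) \<le> N1 + N2 - 2 * p - 1"
      "2 * (a + b2) \<le> N2 + N - 2 * p - 1" for a b a1 b1 a2 b2 :: int
    using that by presburger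
  ultimately show ?thesis by presburger
qed

text \<open>Allows coordinates to be named by their role in a sign pattern; the six orders are
  settled here once.\<close>

lemma coord_perm:
  assumes "i < 3" "j < 3" "k < 3" "i \<noteq> j" "j \<noteq> k" "k \<noteq> i"
  shows "l1 u v = \<bar>coord u i - coord v i\<bar> + \<bar>coord u j - coord v j\<bar> + \<bar>coord u k - coord v k\<bar>"
    and "l1_norm u = \<bar>coord u i\<bar> + \<bar>coord u j\<bar> + \<bar>coord u k\<bar>"
    and "min_abs u \<le> \<bar>coord u i\<bar>"
proof -
  obtain a b c a' b' c' where [simp]: "u = (a, b, c)" "v = (a', b', c')"
    by (metis prod_cases3)
  have cs: "(i, j, k) \<in> {(0, 1, 2), (0, 2, 1), (1, 0, 2), (1, 2, 0), (2, 0, 1), (2, 1, 0)}"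
    using assms by (auto simp: less_Suc_eq numeral_3_eq_3 numeral_2_eq_2)
  show "l1 u v = \<bar>coord u i - coord v i\<bar> + \<bar>coord u j - coord v j\<bar> + \<bar>coord u k - coord v k\<bar>"
    "l1_norm u = \<bar>coord u i\<bar> + \<bar>coord u j\<bar> + \<bar>coord u k\<bar>"
    "min_abs u \<le> \<bar>coord u i\<bar>"
    using cs by auto
qed

lemma argmax_less: "argmax u < 3" and argmin_less: "argmin u < 3"
  by (cases u; simp)+

lemma argmax_neq_argmin: "u \<in> Vec \<Longrightarrow> l1_norm u \<ge> 2 \<Longrightarrow> argmax u \<noteq> argmin u"
  using argmax_bound[of u] argmin_bound[of u] by auto

text \<open>In the order i, j, k the vectors read v = (+, -, z), u = (z, +, -), w = (-, z, +), which
  is the setting of \<open>cyclic_pattern\<close>. Its bound on the middle coordinates passes to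
  \<open>min_abs\<close>, which is at most the absolute value of any coordinate.\<close>

lemma three_far_cyclic:
  assumes p: "p \<ge> 8" and uvw: "v \<in> shell (p - 2) (p + 3)" "u \<in> shell (p + 1) (p + 3)" "w \<in> shell (p + 1) (p + 3)"
    and far: "l1 v u > 2 * p" "l1 u w > 2 * p" "l1 w v > 2 * p"
    and cyc: "argmax u = argmin v" "argmax w = argmin u" "argmax v = argmin w"
  shows "min_abs v + min_abs u + min_abs w \<le> l1_norm v + l1_norm u + l1_norm w - 3 * p - 2"
proof -
  define i j k where "i = argmax v" and "j = argmax u" and "k = argmax w"
  have Vec: "v \<in> Vec" "u \<in> Vec" "w \<in> Vec" using uvw by (auto simp: shell_def)
  have norms: "p - 2 \<le> l1_norm v" "l1_norm v \<le> p + 3" "p + 1 \<le> l1_norm u" "l1_norm u \<le> p + 3"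
    "p + 1 \<le> l1_norm w" "l1_norm w \<le> p + 3"
    using uvw by (auto simp: shell_def)
  have ij: "i \<noteq> j" "j \<noteq> k" "k \<noteq> i"
    using argmax_neq_argmin[OF Vec(1)] argmax_neq_argmin[OF Vec(2)] argmax_neq_argmin[OF Vec(3)] norms p cyc
    by (auto simp: i_def j_def k_def)
  have lt: "i < 3" "j < 3" "k < 3" using argmax_less by (auto simp: i_def j_def k_def)
  note perm = coord_perm[OF lt ij] coord_perm(3)[OF lt(2,3,1) ij(2,3,1)] coord_perm(3)[OF lt(3,1,2) ij(3,1,2)]
  have pos: "l1_norm v \<le> 4 * coord v i" "l1_norm u \<le> 4 * coord u j" "l1_norm w \<le> 4 * coord w k"
    using argmax_bound Vec by (auto simp: i_def j_def k_def)
  have neg: "l1_norm v - 1 \<le> 4 * - coord v j" "l1_norm u - 1 \<le> 4 * - coord u k" "l1_norm w - 1 \<le> 4 * - coord w i"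
    using argmin_bound[OF Vec(1)] argmin_bound[OF Vec(2)] argmin_bound[OF Vec(3)] cyc
    by (auto simp: i_def j_def k_def)
  have sgn: "coord v i \<ge> 0" "coord u j \<ge> 0" "coord w k \<ge> 0"
    "coord v j \<le> 0" "coord u k \<le> 0" "coord w i \<le> 0"
    using pos neg norms p by linarith+
  have N: "coord v i + - coord v j + \<bar>coord v k\<bar> = l1_norm v"
    "coord u j + - coord u k + \<bar>coord u i\<bar> = l1_norm u"
    "coord w k + - coord w i + \<bar>coord w j\<bar> = l1_norm w"
    using sgn perm(2) by auto
  have D: "l1 v u = \<bar>coord v i - coord u i\<bar> + (- coord v j + coord u j) + \<bar>coord v k + - coord u k\<bar>"
    "l1 u w = \<bar>coord u j - coord w j\<bar> + (- coord u k + coord w k) + \<bar>coord u i + - coord w i\<bar>"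
    "l1 w v = \<bar>coord w k - coord v k\<bar> + (coord v i + - coord w i) + \<bar>coord w j + - coord v j\<bar>"
    unfolding perm(1) using sgn by auto
  note far' = far[unfolded D]
  have "\<bar>coord v k\<bar> + \<bar>coord u i\<bar> + \<bar>coord w j\<bar> \<le> l1_norm v + l1_norm u + l1_norm w - 3 * p - 2"
    by (rule cyclic_pattern[of p "coord v i" "- coord v j" "coord v k" "coord u j" "- coord u k" "coord u i"
        "coord w k" "- coord w i" "coord w j", unfolded N, OF p norms pos neg far'])
  moreover have "min_abs u \<le> \<bar>coord u i\<bar>" "min_abs w \<le> \<bar>coord w j\<bar>" "min_abs v \<le> \<bar>coord v k\<bar>"
    using perm(3-5) by blast+
  moreover have "a + b + c \<le> M" if "x + y + z \<le> M" "b \<le> y" "c \<le> z" "a \<le> x" for a b c x y z M :: int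
    using that by linarith
  ultimately show ?thesis by blast
qed

text \<open>The positions of the maxima and of the minima are both permutations of the three
  coordinates, and they never agree on a vector. A permutation of three points without fixed point
  is one of two 3-cycles, and exchanging u and w turns one into the other.\<close>

lemma three_far:
  assumes p: "p \<ge> 8" and u: "u \<in> shell (p + 1) (p + 3)" and w: "w \<in> shell (p + 1) (p + 3)"
    and v: "v \<in> shell (p + 1) (p + 3) \<union> shell (p - 2) p"
    and far: "l1 u w > 2 * p" "l1 u v > 2 * p" "l1 w v > 2 * p"
  shows "min_abs u + min_abs w + min_abs v \<le> l1_norm u + l1_norm w + l1_norm v - 3 * p - 2"
proof -
  have v': "v \<in> shell (p - 2) (p + 3)" using v by (auto simp: shell_def)
  have "l1 a b = l1 b a" for a b by (cases a; cases b) (simp add: abs_minus_commute)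
  then have far': "l1 w u > 2 * p" "l1 v u > 2 * p" "l1 v w > 2 * p"
    using far by metis+
  have mx: "argmax u \<noteq> argmax w" "argmax u \<noteq> argmax v" "argmax w \<noteq> argmax v"
    using argmax_neq p u w v far by auto
  have mn: "argmin u \<noteq> argmin w" "argmin u \<noteq> argmin v" "argmin w \<noteq> argmin v"
    using argmin_neq p u w v far by auto
  have ne: "argmax u \<noteq> argmin u" "argmax w \<noteq> argmin w" "argmax v \<noteq> argmin v"
    using argmax_neq_argmin[of u] argmax_neq_argmin[of w] argmax_neq_argmin[of v] u w v' p
    by (simp_all add: shell_def)
  have three: "argmax u < 3" "argmax w < 3" "argmax v < 3" "argmin u < 3" "argmin w < 3" "argmin v < 3"
    by (simp_all add: argmax_less argmin_less)
  have third: "x = c" if "x \<noteq> a" "x \<noteq> b" "a \<noteq> b" "c \<noteq> a" "c \<noteq> b" "x < 3" "a < 3" "b < 3" "c < 3"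
    for x a b c :: nat
  proof -
    have "card {a, b, c} = 3" using that(3-5) by auto
    then have "{a, b, c} = {..<3}" using that(7-9) by (intro card_subset_eq) auto
    then have "x \<in> {a, b, c}" using that(6) by blast
    then show ?thesis using that(1,2) by blast
  qed
  show ?thesis
  proof (cases "argmax u = argmin v")
    case True
    have "argmin w = argmax v"
      using True third[of "argmin w" "argmax u" "argmax w" "argmax v"] mx mn three ne by metis
    moreover from this have "argmin u = argmax w"
      using True third[of "argmin u" "argmax u" "argmax v" "argmax w"] mx mn three ne by metis
    ultimately have "argmax w = argmin u" "argmax v = argmin w" by simp_all
    then show ?thesis using three_far_cyclic[OF p v' u w] True far far' by simp
  next
    case False
    have "argmin v = argmax w"
      using False third[of "argmin v" "argmax u" "argmax v" "argmax w"] mx mn three ne by metis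
    moreover from this have "argmin u = argmax v"
      using third[of "argmin u" "argmax u" "argmax w" "argmax v"] mx mn three ne by metis
    moreover from this have "argmin w = argmax u"
      using third[of "argmin w" "argmax w" "argmax v" "argmax u"] mx mn three ne by metis
    ultimately have "argmax w = argmin v" "argmax u = argmin w" "argmax v = argmin u" by simp_all
    then show ?thesis using three_far_cyclic[OF p v' w u] far far' by simp
  qed
qed

section \<open>Weight of one colour class\<close>

lemma argmax_inj_on:
  assumes p: "p \<ge> 8" and S: "S \<subseteq> shell (p + 1) (p + 3)" and far: "pairwise (\<lambda>u v. l1 u v > 2 * p) S"
  shows "inj_on argmax S"
proof (rule inj_onI, rule ccontr)
  fix u w assume "u \<in> S" "w \<in> S" "argmax u = argmax w" "u \<noteq> w"
  then show False using argmax_neq[OF p, of u w] S pairwiseD[OF far, of u w] by auto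
qed

text \<open>Distinct positions of the maximum leave at most three members. Two weigh at most 3 + 3,
  and three at most 7 by \<open>three_far\<close>.\<close>

lemma outer_class_weight:
  assumes p: "p \<ge> 8" and S: "S \<subseteq> shell (p + 1) (p + 3)" and far: "pairwise (\<lambda>u v. l1 u v > 2 * p) S"
  shows "sum (weight p) S \<le> 8"
proof -
  note inj = argmax_inj_on[OF p S far]
  have "argmax ` S \<subseteq> {..<3}" using argmax_less by auto
  then have fin: "finite S" and "card S \<le> 3"
    using card_inj_on_le[OF inj, of "{..<3}"] inj_on_finite[OF inj, of "{..<3}"] by auto
  have w3: "weight p u \<le> 3" for u by (simp add: weight_def min_def)
  consider "card S \<le> 2" | "card S = 3" using \<open>card S \<le> 3\<close> by linarith
  then show ?thesis
  proof cases
    case 1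
    then show ?thesis using sum_bounded_above[of S "weight p" 3] w3 by simp
  next
    case 2
    then obtain u v w where S3: "S = {u, v, w}" "u \<noteq> v" "v \<noteq> w" "u \<noteq> w" by (auto simp: card_3_iff)
    then have "min_abs u + min_abs v + min_abs w \<le> l1_norm u + l1_norm v + l1_norm w - 3 * p - 2"
      using S far by (intro three_far[OF p]) (auto simp: pairwise_def)
    then show ?thesis using S3 weight_le[of p u] weight_le[of p v] weight_le[of p w] by simp
  qed
qed

text \<open>The vector v occupies one position of the maximum, so at most two outer members remain.
  Two of them are bounded by the first term of \<open>capacity\<close> through
  \<open>three_far\<close>, a single one by the second term.\<close>

lemma inner_class_weight:
  assumes p: "p \<ge> 8" and v: "v \<in> shell (p - 2) p"
    and S: "S \<subseteq> shell (p + 1) (p + 3)" and far: "pairwise (\<lambda>u v. l1 u v > 2 * p) S"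
    and far_v: "\<And>u. u \<in> S \<Longrightarrow> l1 u v > 2 * p"
  shows "sum (weight p) S \<le> capacity p v"
proof -
  have "argmax u \<noteq> argmax v" if "u \<in> S" for u
    using argmax_neq[OF p, of u v] that S far_v v by auto
  then have inj: "inj_on argmax (insert v S)"
    unfolding inj_on_insert using argmax_inj_on[OF p S far] by (metis DiffD1 imageE)
  have "argmax ` insert v S \<subseteq> {..<3}" using argmax_less by auto
  then have fin: "finite S" and "card (insert v S) \<le> 3"
    using card_inj_on_le[OF inj, of "{..<3}"] inj_on_finite[OF inj, of "{..<3}"] by auto
  moreover have "v \<notin> S" using v S by (auto simp: shell_def)
  ultimately have "card S \<le> 2" by simp
  then consider "card S = 0" | "card S = 1" | "card S = 2" by linarith
  then show ?thesis
  proof cases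
    case 1
    then show ?thesis using fin by (simp add: capacity_def le_max_iff_disj)
  next
    case 2
    then obtain u where "S = {u}" by (auto simp: card_1_singleton_iff)
    \<comment> \<open>A weight of 3 occurs only on the sphere p + 1, and distance above 2p then puts
      v on the sphere p, where the capacity is at least 3.\<close>
    then have "l1_norm v = p" if "l1_norm u = p + 1"
      using v far_v[of u] that l1_le_norms[of u v] by (simp add: shell_def)
    moreover have "weight p u \<le> (if l1_norm u = p + 1 then 3 else 2)"
      "(if l1_norm v = p then 3 else 2) \<le> capacity p v"
      by (simp_all add: weight_def capacity_def)
    ultimately show ?thesis using \<open>S = {u}\<close> by (auto split: if_splits)
  next
    case 3
    then obtain u w where S2: "S = {u, w}" "u \<noteq> w" by (auto simp: card_2_iff)
    then have "min_abs u + min_abs w + min_abs v \<le> l1_norm u + l1_norm w + l1_norm v - 3 * p - 2"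
      using S far far_v v by (intro three_far[OF p]) (auto simp: pairwise_def)
    then show ?thesis using S2 weight_le[of p u] weight_le[of p w] capacity_ge[of v p] by simp
  qed
qed

section \<open>Summation over spheres\<close>

fun rot :: "vec \<Rightarrow> vec" where "rot (a, b, c) = (b, c, a)"

text \<open>Half-open sides of the hexagonal sphere: each of the six corners is listed once.\<close>
definition sphere_list :: "int \<Rightarrow> vec list" where
  "sphere_list k = (let P = (k + 1) div 2; N = k div 2;
     side = map (\<lambda>a. (a, P - a, - N)) [1..P] @ map (\<lambda>a. (P, - a, a - N)) [1..N]
   in side @ map rot side @ map rot (map rot side))"

definition shell_list :: "int \<Rightarrow> int \<Rightarrow> vec list" where
  "shell_list r s = concat (map sphere_list [r..s])"

section \<open>Certificates for p = 5, 6, 7 by exhaustive search\<close>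

function (sequential) class_max :: "(vec \<Rightarrow> int) \<Rightarrow> int \<Rightarrow> vec list \<Rightarrow> int" where
  "class_max w p [] = 0"
| "class_max w p (u # us) =
     max (w u + class_max w p (filter (\<lambda>v. 2 * p < l1 u v) us)) (class_max w p us)"
  by pat_completeness auto
termination
  by (relation "measure (\<lambda>(w, p, us). length us)") (auto simp: le_imp_less_Suc)

text \<open>An executable dual certificate: \<open>C\<close> bounds the class of the one new colour,
  \<open>y v\<close> the class of the colour of v, and the total weight exceeds what these bounds
  allow.\<close>

definition class_check :: "int \<Rightarrow> (vec \<Rightarrow> int) \<Rightarrow> (vec \<Rightarrow> int) \<Rightarrow> int \<Rightarrow> bool" where
  "class_check p w y C \<longleftrightarrow> (let U = shell_list (p + 1) (p + 3); V = shell_list (p - 2) p in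
     class_max w p U \<le> C \<and>
     list_all (\<lambda>v. class_max w p (filter (\<lambda>u. 2 * p < l1 u v) U) \<le> y v) V \<and>
     C + sum_list (map y V) < sum_list (map w U))"

text \<open>For p = 5 the weights above violate a capacity constraint at the three exceptional points, so they
  are doubled and lowered there.\<close>
definition weight5 :: "vec \<Rightarrow> int" where
  "weight5 u = 2 * weight 5 u - (if u \<in> {(4, - 2, - 2), (- 2, 4, - 2), (- 2, - 2, 4)} then 1 else 0)"

text \<open>Doubling lets a weight drop by one half within the integers; the capacities double with
  it.\<close>

lemma class_check_5: "class_check 5 weight5 (\<lambda>v. 2 * capacity 5 v) 14"
  by code_simp

lemma class_check_6: "class_check 6 (weight 6) (capacity 6) 8"
  by code_simp

lemma class_check_7: "class_check 7 (weight 7) (capacity 7) 8"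
  by code_simp

text \<open>\<open>class_max\<close> branches as for a maximum weight independent set: once u is
  chosen, the other members of the class lie in the tail filtered to vectors far from u.\<close>

lemma sum_le_class_max:
  assumes "S \<subseteq> set us" "pairwise (\<lambda>u v. l1 u v > 2 * p) S"
  shows "sum w S \<le> class_max w p us"
  using assms
proof (induction w p us arbitrary: S rule: class_max.induct)
  case (1 w p)
  then show ?case by simp
next
  case (2 w p u us)
  show ?case
  proof (cases "u \<in> S")
    case True
    have fin: "finite S" using 2(3) by (rule finite_subset) simp
    have "S - {u} \<subseteq> set (filter (\<lambda>v. 2 * p < l1 u v) us)"
      using 2(3) pairwiseD[OF 2(4) True] by auto
    moreover have "pairwise (\<lambda>u v. l1 u v > 2 * p) (S - {u})"
      using 2(4) by (rule pairwise_subset) auto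
    ultimately have "sum w (S - {u}) \<le> class_max w p (filter (\<lambda>v. 2 * p < l1 u v) us)"
      by (rule 2(1))
    then show ?thesis using sum.remove[OF fin True, of w] by simp
  next
    case False
    then have "S \<subseteq> set us" using 2(3) by auto
    then show ?thesis using 2(2)[OF _ 2(4)] by simp
  qed
qed

section \<open>Enumeration of a sphere\<close>

definition hex_sphere :: "int \<Rightarrow> vec set" where
  "hex_sphere k = {u \<in> Vec. l1_norm u = k}"

lemma in_set_side:
  fixes P N :: int
  shows "(a, b, c) \<in> set (map (\<lambda>a. (a, P - a, - N)) [1..P] @ map (\<lambda>a. (P, - a, a - N)) [1..N])
    \<longleftrightarrow> (1 \<le> a \<and> 0 \<le> b \<and> a + b = P \<and> c = - N) \<or> (a = P \<and> b \<le> - 1 \<and> c \<le> 0 \<and> b + c = - N)"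
proof -
  have "(\<exists>x\<in>{1..N}. b = - x \<and> c = x - N) \<longleftrightarrow> b \<le> - 1 \<and> c \<le> 0 \<and> b + c = - N"
    by (intro iffI bexI[of _ "- b"]) auto
  then show ?thesis by auto
qed

lemma in_rot_image: "(a, b, c) \<in> rot ` S \<longleftrightarrow> (c, a, b) \<in> S"
proof
  assume "(c, a, b) \<in> S"
  then show "(a, b, c) \<in> rot ` S" by (intro image_eqI[of _ _ "(c, a, b)"]) simp
qed auto

text \<open>Norm and sum have the same parity, so on the sphere the sum is P - N: the positive
  coordinates add up to P and the negative ones to - N. Each sign pattern is then one half-open
  side.\<close>

lemma set_sphere_list:
  assumes "k \<ge> 1"
  shows "set (sphere_list k) = hex_sphere k"
proof -
  define P N where "P = (k + 1) div 2" and "N = k div 2"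
  have PN: "P + N = k" "P - N = 0 \<or> P - N = 1" "P \<ge> 1" "N \<ge> 0"
    using assms unfolding P_def N_def by presburger+
  have "(a, b, c) \<in> set (sphere_list k) \<longleftrightarrow> (a, b, c) \<in> hex_sphere k" for a b c
  proof -
    let ?Q = "\<lambda>a b c. (1 \<le> a \<and> 0 \<le> b \<and> a + b = P \<and> c = - N) \<or> (a = P \<and> b \<le> - 1 \<and> c \<le> 0 \<and> b + c = - N)"
    have "(a, b, c) \<in> set (sphere_list k) \<longleftrightarrow> ?Q a b c \<or> ?Q c a b \<or> ?Q b c a"
      unfolding sphere_list_def Let_def P_def[symmetric] N_def[symmetric] set_append[of _ "_ @ _"]
        set_append[of "map rot _"] set_map[of rot] Un_iff in_rot_image in_set_side by blast
    also have "\<dots> \<longleftrightarrow> (a + b + c = 0 \<or> a + b + c = 1) \<and> \<bar>a\<bar> + \<bar>b\<bar> + \<bar>c\<bar> = k" (is "?L \<longleftrightarrow> ?R")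
    proof
      have "x + y + z = P - N \<and> \<bar>x\<bar> + \<bar>y\<bar> + \<bar>z\<bar> = P + N" if "?Q x y z" for x y z
        using that
      proof
        assume "1 \<le> x \<and> 0 \<le> y \<and> x + y = P \<and> z = - N"
        then show ?thesis using PN by simp
      next
        assume "x = P \<and> y \<le> - 1 \<and> z \<le> 0 \<and> y + z = - N"
        then show ?thesis using PN by simp
      qed
      from this[of a b c] this[of c a b] this[of b c a]
      show "?L \<Longrightarrow> ?R" using PN(1,2) by (elim disjE[of "?Q a b c"] disjE[of "?Q c a b"]) (simp_all add: ac_simps)
    next
      assume R: ?R
      \<comment> \<open>Seven cases for six sides: the side with b = - N, c \<ge> 1 and a \<ge> 0 is
        split by whether a is positive.\<close>
      have sign_cases: L if "a \<ge> 1 \<Longrightarrow> b \<ge> 0 \<Longrightarrow> L" "a \<ge> 1 \<Longrightarrow> b \<le> -1 \<Longrightarrow> c \<ge> 1 \<Longrightarrow> L"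
        "a \<ge> 1 \<Longrightarrow> b \<le> -1 \<Longrightarrow> c \<le> 0 \<Longrightarrow> L" "a \<le> 0 \<Longrightarrow> b \<ge> 1 \<Longrightarrow> c \<ge> 0 \<Longrightarrow> L"
        "a \<le> 0 \<Longrightarrow> b \<ge> 1 \<Longrightarrow> c \<le> -1 \<Longrightarrow> L" "a = 0 \<Longrightarrow> b \<le> 0 \<Longrightarrow> L" "a \<le> -1 \<Longrightarrow> b \<le> 0 \<Longrightarrow> L" for L
      proof -
        have "t \<ge> 1 \<or> t = 0 \<or> t \<le> -1" for t :: int by auto
        from this[of a] this[of b] this[of c] show ?thesis using that by auto
      qed
      have "even (\<bar>t\<bar> - t)" for t :: int by (simp add: abs_if)
      then have "even (\<bar>a\<bar> - a + (\<bar>b\<bar> - b) + (\<bar>c\<bar> - c))" by simp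
      moreover have "\<bar>a\<bar> - a + (\<bar>b\<bar> - b) + (\<bar>c\<bar> - c) = P + N - (a + b + c)" using R PN(1) by simp
      ultimately have "even (P + N - (a + b + c))" by simp
      then have s: "a + b + c = P - N"
        using R PN(2) by presburger
      have PN1: "P - N \<le> 1" using PN(2) by auto
      have abs: "\<bar>a\<bar> + \<bar>b\<bar> + \<bar>c\<bar> = P + N" using R PN(1) by simp
      have ?L if "a \<ge> 1" "b \<ge> 0"
      proof -
        have "a + b = P" "c = - N" using that s abs PN(3,4) PN1 by linarith+
        then show ?thesis using that by simp
      qed
      moreover have ?L if "a \<ge> 1" "b \<le> -1" "c \<ge> 1"
      proof -
        have "c + a = P" "b = - N" using that s abs PN(3,4) PN1 by linarith+
        then show ?thesis using that by simp
      qed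
      moreover have ?L if "a \<ge> 1" "b \<le> -1" "c \<le> 0"
      proof -
        have "a = P" "b + c = - N" using that s abs PN(3,4) PN1 by linarith+
        then show ?thesis using that by simp
      qed
      moreover have ?L if "a \<le> 0" "b \<ge> 1" "c \<ge> 0"
      proof -
        have "b + c = P" "a = - N" using that s abs PN(3,4) PN1 by linarith+
        then show ?thesis using that by simp
      qed
      moreover have ?L if "a \<le> 0" "b \<ge> 1" "c \<le> -1"
      proof -
        have "b = P" "c + a = - N" using that s abs PN(3,4) PN1 by linarith+
        then show ?thesis using that by simp
      qed
      moreover have ?L if "a = 0" "b \<le> 0"
      proof -
        have "c + a = P" "b = - N" "1 \<le> c" using that s abs PN(3,4) PN1 by linarith+
        then show ?thesis using that by simp
      qed
      moreover have ?L if "a \<le> -1" "b \<le> 0"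
      proof -
        have "c = P" "a + b = - N" using that s abs PN(3,4) PN1 by linarith+
        then show ?thesis using that by simp
      qed
      ultimately show ?L by (rule sign_cases)
    qed
    finally show ?thesis by (simp add: hex_sphere_def Vec_def)
  qed
  then show ?thesis by auto
qed

lemma distinct_sphere_list:
  assumes "k \<ge> 1"
  shows "distinct (sphere_list k)"
proof -
  define P N where "P = (k + 1) div 2" and "N = k div 2"
  have PN: "P \<ge> 1" "N \<ge> 0"
    using assms unfolding P_def N_def by presburger+
  define side where "side = map (\<lambda>a. (a, P - a, - N)) [1..P] @ map (\<lambda>a. (P, - a, a - N)) [1..N]"
  \<comment> \<open>Rotation moves the positive coordinate to a place that is nonpositive on another
    copy, which keeps the three copies disjoint.\<close>
  have side: "a \<ge> 1 \<and> c \<le> 0" if "(a, b, c) \<in> set side" for a b c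
    using that PN unfolding side_def in_set_side by auto
  have "inj rot" by (auto simp: inj_def)
  then have inj: "inj_on rot A" for A by (rule inj_on_subset) simp
  have "distinct side"
    unfolding side_def by (auto simp: distinct_map inj_on_def)
  moreover have "set side \<inter> rot ` set side = {}" "set side \<inter> rot ` rot ` set side = {}"
    "rot ` set side \<inter> rot ` rot ` set side = {}"
    using side by (auto simp: disjoint_iff in_rot_image) (meson not_one_le_zero order_trans)+
  moreover have "sphere_list k = side @ map rot side @ map rot (map rot side)"
    unfolding sphere_list_def Let_def side_def P_def N_def ..
  ultimately show ?thesis
    by (simp only: distinct_append distinct_map set_append set_map inj Int_Un_distrib) simp
qed

lemma sum_hex_sphere:
  assumes "k \<ge> 1"
  shows "sum f (hex_sphere k) = sum_list (map f (sphere_list k))"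
  using sum_list_distinct_conv_sum_set[OF distinct_sphere_list[OF assms], of f] set_sphere_list[OF assms] by simp

lemma finite_hex_sphere: "k \<ge> 1 \<Longrightarrow> finite (hex_sphere k)"
  by (metis List.finite_set set_sphere_list)

lemma shell_UN: "shell r s = (\<Union>k\<in>{r..s}. hex_sphere k)"
  by (auto simp: shell_def hex_sphere_def)

lemma finite_shell: "r \<ge> 1 \<Longrightarrow> finite (shell r s)"
  unfolding shell_UN by (intro finite_UN_I) (auto intro: finite_hex_sphere)

lemma sum_shell:
  fixes f :: "vec \<Rightarrow> int"
  assumes "r \<ge> 1"
  shows "sum f (shell r s) = (\<Sum>k\<in>{r..s}. sum f (hex_sphere k))"
  unfolding shell_UN
proof (intro sum.UNION_disjoint ballI impI)
  show "finite (hex_sphere k)" if "k \<in> {r..s}" for k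
    using that assms by (simp add: finite_hex_sphere)
qed (auto simp: hex_sphere_def)

lemma set_shell_list: "r \<ge> 1 \<Longrightarrow> set (shell_list r s) = shell r s"
  by (auto simp: shell_list_def shell_UN set_sphere_list)

lemma sum_shell_list:
  fixes f :: "vec \<Rightarrow> int"
  assumes "r \<ge> 1"
  shows "sum_list (map f (shell_list r s)) = sum f (shell r s)"
proof -
  have "sum_list (map f (concat xss)) = sum_list (map (\<lambda>xs. sum_list (map f xs)) xss)" for xss
    by (induction xss) simp_all
  then have "sum_list (map f (shell_list r s)) = sum_list (map (\<lambda>k. sum_list (map f (sphere_list k))) [r..s])"
    by (simp add: shell_list_def comp_def)
  also have "\<dots> = (\<Sum>k\<in>{r..s}. sum_list (map f (sphere_list k)))"
    by (simp add: interv_sum_list_conv_sum_set_int)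
  finally show ?thesis using assms by (simp add: sum_shell sum_hex_sphere)
qed

section \<open>Total weight and total capacity\<close>

lemma sum_side:
  fixes g :: "int \<Rightarrow> int"
  assumes "n \<ge> 3" "g 1 = h1" "g (n - 1) = h1" "g n = h0" "\<And>a. 2 \<le> a \<Longrightarrow> a \<le> n - 2 \<Longrightarrow> g a = h2"
  shows "sum g {1..n} = h0 + 2 * h1 + (n - 3) * h2"
proof -
  have "{1..n} = insert 1 (insert (n - 1) (insert n {2..n - 2}))" using assms(1) by auto
  moreover have "sum g {2..n - 2} = (\<Sum>a\<in>{2..n - 2}. h2)" using assms(5) by (intro sum.cong) auto
  ultimately show ?thesis using assms(1-4) by simp
qed

text \<open>Each of the six sides has one corner with \<open>min_abs\<close> 0, two vectors next to
  corners with \<open>min_abs\<close> 1, and otherwise larger values. The hypothesis k \<ge> 6 gives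
  every side length at least 3, so that these three vectors are distinct.\<close>

lemma sum_hex_sphere_by_min_abs:
  fixes f :: "vec \<Rightarrow> int"
  assumes k: "k \<ge> 6"
    and f: "\<And>u. u \<in> hex_sphere k \<Longrightarrow> min_abs u = 0 \<Longrightarrow> f u = h0"
      "\<And>u. u \<in> hex_sphere k \<Longrightarrow> min_abs u = 1 \<Longrightarrow> f u = h1"
      "\<And>u. u \<in> hex_sphere k \<Longrightarrow> min_abs u \<ge> 2 \<Longrightarrow> f u = h2"
  shows "sum f (hex_sphere k) = 6 * h0 + 12 * h1 + 3 * (k - 6) * h2"
proof -
  define P N where "P = (k + 1) div 2" and "N = k div 2"
  have PN: "P + N = k" "P - N = 0 \<or> P - N = 1" "P \<ge> 3" "N \<ge> 3"
    using k unfolding P_def N_def by presburger+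
  define side where "side = map (\<lambda>a. (a, P - a, - N)) [1..P] @ map (\<lambda>a. (P, - a, a - N)) [1..N]"
  have sph: "sphere_list k = side @ map rot side @ map rot (map rot side)"
    unfolding sphere_list_def Let_def side_def P_def N_def ..
  have side_sum: "sum_list (map (f \<circ> r) side) = 2 * h0 + 4 * h1 + (k - 6) * h2"
    if r: "\<And>u. min_abs (r u) = min_abs u" and mem: "\<And>u. u \<in> set side \<Longrightarrow> r u \<in> hex_sphere k" for r
  proof -
    have in1: "r (a, P - a, - N) \<in> hex_sphere k" if "1 \<le> a" "a \<le> P" for a
      using that by (intro mem) (auto simp: side_def)
    have in2: "r (P, - a, a - N) \<in> hex_sphere k" if "1 \<le> a" "a \<le> N" for a
      using that by (intro mem) (auto simp: side_def)
    have "sum_list (map (f \<circ> r) side) =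
        (\<Sum>a\<in>{1..P}. f (r (a, P - a, - N))) + (\<Sum>a\<in>{1..N}. f (r (P, - a, a - N)))"
      by (simp add: side_def comp_def interv_sum_list_conv_sum_set_int)
    also have "(\<Sum>a\<in>{1..P}. f (r (a, P - a, - N))) = h0 + 2 * h1 + (P - 3) * h2"
    proof (rule sum_side)
      show "f (r (1, P - 1, - N)) = h1" using in1[of 1] PN by (intro f) (auto simp: r)
      show "f (r (P - 1, P - (P - 1), - N)) = h1" using in1[of "P - 1"] PN by (intro f) (auto simp: r)
      show "f (r (P, P - P, - N)) = h0" using in1[of P] PN by (intro f) (auto simp: r)
      show "f (r (a, P - a, - N)) = h2" if "2 \<le> a" "a \<le> P - 2" for a
        using in1[of a] PN that by (intro f) (auto simp: r)
    qed (use PN in simp)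
    also have "(\<Sum>a\<in>{1..N}. f (r (P, - a, a - N))) = h0 + 2 * h1 + (N - 3) * h2"
    proof (rule sum_side)
      show "f (r (P, - 1, 1 - N)) = h1" using in2[of 1] PN by (intro f) (auto simp: r)
      show "f (r (P, - (N - 1), N - 1 - N)) = h1" using in2[of "N - 1"] PN by (intro f) (auto simp: r)
      show "f (r (P, - N, N - N)) = h0" using in2[of N] PN by (intro f) (auto simp: r)
      show "f (r (P, - a, a - N)) = h2" if "2 \<le> a" "a \<le> N - 2" for a
        using in2[of a] PN that by (intro f) (auto simp: r)
    qed (use PN in simp)
    finally show ?thesis using PN(1)[symmetric] by (simp add: algebra_simps comp_def)
  qed
  have rot: "min_abs (rot u) = min_abs u" for u by (cases u) (simp add: min.commute min.left_commute)
  have set: "set (sphere_list k) = hex_sphere k" using k by (intro set_sphere_list) simp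
  have sub: "u \<in> hex_sphere k" "rot u \<in> hex_sphere k" "rot (rot u) \<in> hex_sphere k" if "u \<in> set side" for u
    unfolding set[symmetric] sph using that by auto
  have "sum f (hex_sphere k) = sum_list (map f (sphere_list k))" using k by (intro sum_hex_sphere) simp
  also have "\<dots> = sum_list (map (f \<circ> id) side) + sum_list (map (f \<circ> rot) side) + sum_list (map (f \<circ> (\<lambda>u. rot (rot u))) side)"
    by (simp add: sph comp_def)
  also have "\<dots> = 3 * (2 * h0 + 4 * h1 + (k - 6) * h2)"
    using side_sum[of id] side_sum[of rot] side_sum[of "\<lambda>u. rot (rot u)"] rot sub by simp
  finally show ?thesis by (simp add: algebra_simps)
qed

lemma sum_weight:
  assumes "p \<ge> 8"
  shows "sum (weight p) (shell (p + 1) (p + 3)) = 21 * p + 3"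
proof -
  have "{p + 1..p + 3} = {p + 1, p + 2, p + 3}" by auto
  then have "sum (weight p) (shell (p + 1) (p + 3)) = sum (weight p) (hex_sphere (p + 1))
      + sum (weight p) (hex_sphere (p + 2)) + sum (weight p) (hex_sphere (p + 3))"
    using assms by (simp add: sum_shell)
  also have "sum (weight p) (hex_sphere (p + 1)) = 6 * 2 + 12 * 3 + 3 * (p + 1 - 6) * 3"
    using assms by (intro sum_hex_sphere_by_min_abs) (auto simp: weight_def hex_sphere_def)
  also have "sum (weight p) (hex_sphere (p + 2)) = 6 * 1 + 12 * 2 + 3 * (p + 2 - 6) * 2"
    using assms by (intro sum_hex_sphere_by_min_abs) (auto simp: weight_def hex_sphere_def)
  also have "sum (weight p) (hex_sphere (p + 3)) = 6 * 0 + 12 * 1 + 3 * (p + 3 - 6) * 2"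
    using assms by (intro sum_hex_sphere_by_min_abs) (auto simp: weight_def hex_sphere_def)
  finally show ?thesis by simp
qed

lemma sum_capacity:
  assumes "p \<ge> 8"
  shows "sum (capacity p) (shell (p - 2) p) = 21 * p - 6"
proof -
  have "{p - 2..p} = {p - 2, p - 1, p}" by auto
  then have "sum (capacity p) (shell (p - 2) p) = sum (capacity p) (hex_sphere (p - 2))
      + sum (capacity p) (hex_sphere (p - 1)) + sum (capacity p) (hex_sphere p)"
    using assms by (simp add: sum_shell)
  also have "sum (capacity p) (hex_sphere (p - 2)) = 6 * 2 + 12 * 2 + 3 * (p - 2 - 6) * 2"
    using assms by (intro sum_hex_sphere_by_min_abs) (auto simp: capacity_def hex_sphere_def)
  also have "sum (capacity p) (hex_sphere (p - 1)) = 6 * 3 + 12 * 2 + 3 * (p - 1 - 6) * 2"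
    using assms by (intro sum_hex_sphere_by_min_abs) (auto simp: capacity_def hex_sphere_def)
  also have "sum (capacity p) (hex_sphere p) = 6 * 4 + 12 * 3 + 3 * (p - 6) * 3"
    using assms by (intro sum_hex_sphere_by_min_abs) (auto simp: capacity_def hex_sphere_def)
  finally show ?thesis by simp
qed

section \<open>Counting\<close>


text \<open>Weak duality. Outer vectors not coloured c are sent by \<open>g\<close> to a disk vector
  of the same colour; each fibre is monochromatic, hence pairwise far and far from its image, and
  \<open>Y\<close> bounds it. The vectors coloured c form one further class, bounded by
  \<open>C\<close>.\<close>

lemma coloring_weight_bound:
  fixes F :: "vec \<Rightarrow> nat" and w y :: "vec \<Rightarrow> int"
  assumes fin: "finite U" "finite V" and "U \<inter> V = {}"
    and col: "\<And>u v. u \<in> U \<Longrightarrow> v \<in> U \<union> V \<Longrightarrow> F u = F v \<Longrightarrow> u \<noteq> v \<Longrightarrow> l1 u v > 2 * p"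
    and cover: "\<And>u. u \<in> U \<Longrightarrow> F u = c \<or> (\<exists>v\<in>V. F u = F v)"
    and C: "\<And>S. S \<subseteq> U \<Longrightarrow> pairwise (\<lambda>u v. l1 u v > 2 * p) S \<Longrightarrow> sum w S \<le> C"
    and Y: "\<And>S v. v \<in> V \<Longrightarrow> S \<subseteq> U \<Longrightarrow> pairwise (\<lambda>u v. l1 u v > 2 * p) S \<Longrightarrow>
      (\<And>u. u \<in> S \<Longrightarrow> l1 u v > 2 * p) \<Longrightarrow> sum w S \<le> y v"
  shows "sum w U \<le> C + sum y V"
proof -
  let ?Uc = "{u \<in> U. F u = c}" and ?U' = "{u \<in> U. F u \<noteq> c}"
  obtain g where g: "\<And>u. u \<in> ?U' \<Longrightarrow> g u \<in> V \<and> F u = F (g u)"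
    using cover by (metis (mono_tags, lifting) mem_Collect_eq)
  have mono: "pairwise (\<lambda>u v. l1 u v > 2 * p) S" if "S \<subseteq> U" "\<And>u. u \<in> S \<Longrightarrow> F u = d" for S d
  proof (rule pairwiseI)
    fix u v assume uv: "u \<in> S" "v \<in> S" "u \<noteq> v"
    then show "l1 u v > 2 * p" using that(1) that(2)[of u] that(2)[of v] by (intro col) auto
  qed
  have "sum w ?U' = (\<Sum>v\<in>V. sum w {u \<in> ?U'. g u = v})"
    using fin g by (intro sum.group[symmetric]) auto
  also have "\<dots> \<le> sum y V"
  proof (intro sum_mono Y)
    fix v assume v: "v \<in> V"
    show "pairwise (\<lambda>u v. l1 u v > 2 * p) {u \<in> ?U'. g u = v}"
      using g by (intro mono[of _ "F v"]) auto
    show "l1 u v > 2 * p" if "u \<in> {u \<in> ?U'. g u = v}" for u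
      using g[of u] that v assms(3) by (intro col) auto
  qed auto
  finally have "sum w ?U' \<le> sum y V" .
  moreover have "sum w ?Uc \<le> C" by (intro C mono[of _ c]) auto
  moreover have "sum w U = sum w ?Uc + sum w ?U'"
    using fin(1) by (subst sum.union_disjoint[symmetric]) (auto intro: sum.cong)
  ultimately show ?thesis by linarith
qed

lemma one_extra_color_impossible:
  fixes F :: "vec \<Rightarrow> nat" and p :: int
  assumes p: "p \<ge> 5"
    and col: "\<And>u v. u \<in> shell (p + 1) (p + 3) \<Longrightarrow> v \<in> shell (p + 1) (p + 3) \<union> shell (p - 2) p \<Longrightarrow>
      F u = F v \<Longrightarrow> u \<noteq> v \<Longrightarrow> l1 u v > 2 * p"
    and cover: "\<And>u. u \<in> shell (p + 1) (p + 3) \<Longrightarrow> F u = c \<or> (\<exists>v\<in>shell (p - 2) p. F u = F v)"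
  shows False
proof -
  let ?U = "shell (p + 1) (p + 3)" and ?V = "shell (p - 2) p"
  let ?far = "\<lambda>u v. l1 u v > 2 * p"
  have fin: "finite ?U" "finite ?V" using p by (simp_all add: finite_shell)
  have disj: "?U \<inter> ?V = {}" by (auto simp: shell_def)
  note bound = coloring_weight_bound[OF fin disj col cover]
  have checked: False if "class_check p w y C" for w y C
  proof -
    have U: "set (shell_list (p + 1) (p + 3)) = ?U" "sum_list (map w (shell_list (p + 1) (p + 3))) = sum w ?U"
      and V: "set (shell_list (p - 2) p) = ?V" "sum_list (map y (shell_list (p - 2) p)) = sum y ?V"
      using p by (simp_all add: set_shell_list sum_shell_list)
    have check: "class_max w p (shell_list (p + 1) (p + 3)) \<le> C" "C + sum y ?V < sum w ?U"
      "\<And>v. v \<in> ?V \<Longrightarrow> class_max w p (filter (\<lambda>u. 2 * p < l1 u v) (shell_list (p + 1) (p + 3))) \<le> y v"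
      using that unfolding class_check_def Let_def list_all_iff U V by auto
    have "sum w ?U \<le> C + sum y ?V"
    proof (rule bound)
      show "sum w S \<le> C" if "S \<subseteq> ?U" "pairwise ?far S" for S
        using sum_le_class_max[of S "shell_list (p + 1) (p + 3)" p w] that check(1) unfolding U by simp
      show "sum w S \<le> y v" if "v \<in> ?V" "S \<subseteq> ?U" "pairwise ?far S" "\<And>u. u \<in> S \<Longrightarrow> ?far u v" for S v
      proof -
        have "S \<subseteq> set (filter (\<lambda>u. 2 * p < l1 u v) (shell_list (p + 1) (p + 3)))"
          using that U by auto
        from sum_le_class_max[OF this that(3)] check(3)[OF that(1)] show ?thesis
          by (rule order_trans)
      qed
    qed
    then show False using check(2) by simp
  qed
  consider "p = 5" | "p = 6" | "p = 7" | "p \<ge> 8" using p by linarith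
  then show False
  proof cases
    case 1
    then show ?thesis using checked class_check_5 by blast
  next
    case 2
    then show ?thesis using checked class_check_6 by blast
  next
    case 3
    then show ?thesis using checked class_check_7 by blast
  next
    case 4
    have "sum (weight p) ?U \<le> 8 + sum (capacity p) ?V"
      using outer_class_weight[OF 4] inner_class_weight[OF 4] by (intro bound) auto
    then show ?thesis using sum_weight[OF 4] sum_capacity[OF 4] by simp
  qed
qed

section \<open>Return to the grid\<close>

lemma inj_to_vtx: "u \<in> Vec \<Longrightarrow> v \<in> Vec \<Longrightarrow> to_vtx x u = to_vtx x v \<Longrightarrow> u = v"
  by (cases u; cases v) (auto simp: Vec_def)

lemma subset_singleton_if_card_less_2:
  assumes "finite A" "\<not> card A \<ge> 2"
  shows "\<exists>c. A \<subseteq> {c}"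
proof -
  have "card A = 0 \<or> card A = 1" using assms(2) by linarith
  then show ?thesis using assms(1) by (auto simp: card_1_singleton_iff)
qed

theorem theorem2:
  fixes p n :: nat and x :: vtx and f :: "vtx \<Rightarrow> nat"
  assumes "p \<ge> 5"
    and "right_vertex x"
    and "distance_coloring (2 * p) n f"
  shows "card (f ` (sphere x (p + 1) \<union> sphere x (p + 2) \<union> sphere x (p + 3))
                - f ` disk_verts x p) \<ge> 2"
proof (rule ccontr)
  define A where "A = f ` (sphere x (p + 1) \<union> sphere x (p + 2) \<union> sphere x (p + 3)) - f ` disk_verts x p"
  let ?F = "\<lambda>u. f (to_vtx x u)"
  note dist = hex_dist_to_vtx[OF assms(2)]
  have origin: "(0, 0, 0) \<in> Vec" "to_vtx x (0, 0, 0) = x"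
    and l1_origin: "l1 (0, 0, 0) u = l1_norm u" "l1 u (0, 0, 0) = l1_norm u" for u
    by (simp add: Vec_def, simp, (cases u; simp)+)
  have norm: "int (hex_dist x (to_vtx x u)) = l1_norm u" "int (hex_dist (to_vtx x u) x) = l1_norm u"
    if "u \<in> Vec" for u
    using dist[OF origin(1) that] dist[OF that origin(1)] by (simp_all add: origin l1_origin)
  have far: "l1 u v > 2 * int p" if "u \<in> Vec" "v \<in> Vec" "?F u = ?F v" "u \<noteq> v" for u v
    using assms(3) dist[OF that(1,2)] inj_to_vtx[OF that(1,2)] that(3,4)
    unfolding distance_coloring_def by (metis linorder_not_less of_nat_le_iff of_nat_mult of_nat_numeral)
  assume "\<not> card (f ` (sphere x (p + 1) \<union> sphere x (p + 2) \<union> sphere x (p + 3)) - f ` disk_verts x p) \<ge> 2"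
  then have few: "\<not> card A \<ge> 2" by (simp add: A_def)
  \<comment> \<open>Finiteness matters because \<open>card\<close> of an infinite set is 0, so a
    small \<open>card\<close> would not limit the new colours.\<close>
  have "A \<subseteq> {1..n}" using assms(3) by (auto simp: distance_coloring_def A_def)
  then have "finite A" by (rule finite_subset) simp
  then obtain c where c: "\<And>a. a \<in> A \<Longrightarrow> a = c"
    using subset_singleton_if_card_less_2[OF _ few] by blast
  show False
  proof (rule one_extra_color_impossible[of "int p" ?F c])
    fix u assume u: "u \<in> shell (int p + 1) (int p + 3)"
    then have "u \<in> Vec" by (simp add: shell_def)
    have "hex_dist x (to_vtx x u) = p + 1 \<or> hex_dist x (to_vtx x u) = p + 2 \<or> hex_dist x (to_vtx x u) = p + 3"
      using u norm(1)[OF \<open>u \<in> Vec\<close>] by (auto simp: shell_def)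
    then have outer: "to_vtx x u \<in> sphere x (p + 1) \<union> sphere x (p + 2) \<union> sphere x (p + 3)"
      by (auto simp: sphere_def)
    show "?F u = c \<or> (\<exists>v\<in>shell (int p - 2) (int p). ?F u = ?F v)"
    proof (cases "?F u \<in> f ` disk_verts x p")
      case True
      then obtain z where z: "hex_dist z x \<le> p" "?F u = f z" by (auto simp: disk_verts_def)
      obtain v where v: "v \<in> Vec" "z = to_vtx x v" using to_vtx_onto by metis
      have nv: "l1_norm v \<le> int p" using z(1) norm(2)[OF v(1)] v(2) by simp
      then have "u \<noteq> v" using u by (auto simp: shell_def)
      then have "l1 u v > 2 * int p" using far \<open>u \<in> Vec\<close> v z(2) by blast
      \<comment> \<open>Distance above 2p with u at radius at most p + 3 leaves radius above p - 3
        for v, which is why only three spheres of the disk carry capacity.\<close>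
      then have "int p - 2 \<le> l1_norm v" using l1_le_norms[of u v] u by (simp add: shell_def)
      then have "v \<in> shell (int p - 2) (int p)" using v(1) nv by (simp add: shell_def)
      then show ?thesis using v(2) z(2) by blast
    next
      case False
      then have "?F u \<in> A" using outer unfolding A_def by (intro DiffI imageI)
      then show ?thesis using c by blast
    qed
  next
    fix u v assume "u \<in> shell (int p + 1) (int p + 3)"
      "v \<in> shell (int p + 1) (int p + 3) \<union> shell (int p - 2) (int p)" "?F u = ?F v" "u \<noteq> v"
    then show "l1 u v > 2 * int p" by (intro far) (auto simp: shell_def)
  qed (use assms(1) in simp)
qed

end
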